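(* For every positive integer $t$ there exists a positive integer $k$ such that $\mathrm{bt}(G_k)\ge t$, where $G_k$ is the graph obtained from the complete graph $K_k$ by subdividing every edge into a path of two edges, and $\mathrm{bt}$ denotes book thickness.
   Context: The graph $G_k$ is formed from the complete $k$-vertex graph $K_k$ by subdividing every edge into a path of two edges. Equivalently, the vertices of $G_k$ are the one-element and two-element subsets of a $k$-element set, with an edge between two distinct such subsets exactly when one is contained in the other. Thus $G_k$ has $k+\binom{k}{2}$ vertices and $2\binom{k}{2}$ edges. A straight-line drawing of a graph places the vertices at distinct points of the plane $\mathbb{R}^2$ and draws each edge as the straight line segment between the points representing its endpoints. Two edges cross if their segments share a point that is not a common endpoint of the two edges. The book thickness $\mathrm{bt}(G)$ of a graph $G$ is the minimum number of layers in a straight-line drawing of $G$ in the plane in which each edge is assigned to a single layer and no two edges in the same layer cross, with the further restriction that the vertices of $G$ are placed in convex position (i.e. they are the vertices of a strictly convex polygon). (Edges in different layers may cross; the vertex positions are the same for all layers.) *)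

theory Defs
  imports "HOL-Analysis.Analysis"
begin

text \<open>
  A finite simple graph is given by a vertex set \<open>V\<close> and a set \<open>E\<close> of edges, each edge being the
  two-element set of its endpoints.
\<close>

definition finite_simple_graph :: "'a set \<Rightarrow> 'a set set \<Rightarrow> bool" where
  "finite_simple_graph V E \<longleftrightarrow> finite V \<and> (\<forall>e\<in>E. e \<subseteq> V \<and> card e = 2)"

text \<open>
  The complete graph on \<open>{..<k}\<close> with every edge subdivided once: the singletons are the vertices
  of the complete graph, the two-element sets are the subdivision vertices, and adjacency is proper
  inclusion.
\<close>

definition subdivided_complete_verts :: "nat \<Rightarrow> nat set set" where
  "subdivided_complete_verts k = {s. s \<subseteq> {..<k} \<and> (card s = 1 \<or> card s = 2)}"

definition subdivided_complete_edges :: "nat \<Rightarrow> nat set set set" where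
  "subdivided_complete_edges k =
     {{s, s'} | s s'. s \<in> subdivided_complete_verts k \<and> s' \<in> subdivided_complete_verts k \<and> s \<subset> s'}"

text \<open>
  For an edge \<open>{u, v}\<close> the convex hull below is the segment between the two endpoints,
  see \<open>edge_segment_doubleton\<close>.
\<close>

definition edge_segment :: "('a \<Rightarrow> real^2) \<Rightarrow> 'a set \<Rightarrow> (real^2) set" where
  "edge_segment pos e = convex hull (pos ` e)"

lemma edge_segment_doubleton: "edge_segment pos {u, v} = closed_segment (pos u) (pos v)"
  by (simp add: edge_segment_def segment_convex_hull)

definition edges_cross :: "('a \<Rightarrow> real^2) \<Rightarrow> 'a set \<Rightarrow> 'a set \<Rightarrow> bool" where
  "edges_cross pos e f \<longleftrightarrow> (\<exists>p \<in> edge_segment pos e \<inter> edge_segment pos f. p \<notin> pos ` (e \<inter> f))"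

text \<open>
  Points in convex position: they are exactly the vertices (extreme points) of the polygon
  they span.
\<close>

definition convex_position :: "(real^2) set \<Rightarrow> bool" where
  "convex_position P \<longleftrightarrow> (\<forall>p\<in>P. p extreme_point_of (convex hull P))"

definition book_drawing ::
    "'a set \<Rightarrow> 'a set set \<Rightarrow> nat \<Rightarrow> ('a \<Rightarrow> real^2) \<Rightarrow> ('a set \<Rightarrow> nat) \<Rightarrow> bool" where
  "book_drawing V E n pos layer \<longleftrightarrow>
     inj_on pos V \<and> convex_position (pos ` V) \<and>
     (\<forall>e\<in>E. layer e < n) \<and>
     (\<forall>e\<in>E. \<forall>f\<in>E. e \<noteq> f \<and> layer e = layer f \<longrightarrow> \<not> edges_cross pos e f)"

definition book_thickness :: "'a set \<Rightarrow> 'a set set \<Rightarrow> nat" where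
  "book_thickness V E = (LEAST n. \<exists>pos layer. book_drawing V E n pos layer)"

text \<open>
  The minimum is attained for every finite simple graph: place the vertices on a circle and
  give every edge a layer of its own.
\<close>

lemma book_drawing_exists:
  fixes V :: "'a set"
  assumes "finite_simple_graph V E"
  shows "\<exists>n pos layer. book_drawing V E n pos layer"
proof -
  have finV: "finite V" and "E \<subseteq> Pow V"
    using assms by (auto simp: finite_simple_graph_def)
  then have "finite E"
    by (meson finite_Pow_iff finite_subset)
  then obtain layer :: "'a set \<Rightarrow> nat" and n where lay: "layer ` E = {i. i < n}" "inj_on layer E"
    using finite_imp_inj_to_nat_seg by metis
  obtain g :: "'a \<Rightarrow> nat" where g: "inj_on g V"
    using finV finite_imp_inj_to_nat_seg by metis
  define s :: "'a \<Rightarrow> real" where "s v = 1 / (real (g v) + 1)" for v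
  define pos :: "'a \<Rightarrow> real^2" where "pos v = vector [s v, sqrt (1 - (s v)\<^sup>2)]" for v
  have "inj_on pos V"
  proof (rule inj_onI)
    fix u v assume uv: "u \<in> V" "v \<in> V" "pos u = pos v"
    have "s u = s v"
      using arg_cong[OF uv(3), of "\<lambda>x. x$1"] by (simp add: pos_def)
    then have "g u = g v"
      by (simp add: s_def field_simps)
    then show "u = v"
      using g uv by (auto dest: inj_onD)
  qed
  moreover have "convex_position (pos ` V)"
    unfolding convex_position_def extreme_point_of_def
  proof (intro ballI conjI)
    have "norm (pos v) = 1" for v
    proof -
      have "(s v)\<^sup>2 \<le> 1"
        by (rule power_le_one) (auto simp: s_def)
      then show ?thesis
        by (simp add: pos_def norm_eq_sqrt_inner inner_vec_def sum_2 flip: power2_eq_square)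
    qed
    then have sphere: "pos ` V \<subseteq> sphere 0 1"
      by auto
    then have hull: "convex hull (pos ` V) \<subseteq> cball 0 1"
      by (intro hull_minimal) auto
    fix p assume p: "p \<in> pos ` V"
    then show "p \<in> convex hull (pos ` V)"
      by (rule hull_inc)
    fix a b assume ab: "a \<in> convex hull (pos ` V)" "b \<in> convex hull (pos ` V)"
    show "p \<notin> open_segment a b"
    proof
      assume "p \<in> open_segment a b"
      then have "norm p < norm a \<or> norm p < norm b"
        using dist_decreases_open_segment[of p a b 0] by (auto simp: dist_norm)
      moreover have "norm p = 1" "norm a \<le> 1" "norm b \<le> 1"
        using p ab sphere hull by auto
      ultimately show False by auto
    qed
  qed
  moreover have "\<forall>e\<in>E. layer e < n"
    using lay by blast
  ultimately have "book_drawing V E n pos layer"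
    using lay by (auto simp: book_drawing_def dest: inj_onD)
  then show ?thesis by blast
qed

lemma finite_simple_graph_subdivided_complete:
  "finite_simple_graph (subdivided_complete_verts k) (subdivided_complete_edges k)"
proof -
  have "finite (subdivided_complete_verts k)"
    by (rule finite_subset[of _ "Pow {..<k}"]) (auto simp: subdivided_complete_verts_def)
  then show ?thesis
    by (auto simp: finite_simple_graph_def subdivided_complete_edges_def card_2_iff)
qed

end

theory Submission
  imports Defs "HOL-Library.Ramsey"
begin

text \<open>
  Points in convex position can be ordered by angle around one of them so that
  \<open>a < b < c < d\<close> makes the segments \<open>ac\<close> and \<open>bd\<close> meet. For \<open>i < j\<close> call the edge of the
  subdivided graph from \<open>{i}\<close> to \<open>{i, j}\<close> its lower half and the one from \<open>{j}\<close> its upper half.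
  By Ramsey's theorem for triples, a large \<open>k\<close> yields six original vertices such that all lower
  halves share one layer, all upper halves share one layer, and the order of \<open>{i, j}\<close> relative
  to \<open>{i}\<close>, \<open>{j}\<close>, \<open>{l}\<close> depends only on the order type of \<open>(i, j, l)\<close>. In each of the six
  possible patterns two lower halves or two upper halves cross.
\<close>

section \<open>Convex position and convex combinations\<close>

text \<open>Deleting an extreme point from a convex set leaves a convex set; here that set contains
  \<open>P - {x}\<close>, hence also its hull.\<close>

lemma convex_position_hull_diff:
  assumes "convex_position P" "x \<in> P"
  shows "x \<notin> convex hull (P - {x})"
proof -
  have "convex (convex hull P - {x})"
    using assms extreme_point_of_stillconvex[OF convex_convex_hull]
    by (auto simp: convex_position_def)
  moreover have "P - {x} \<subseteq> convex hull P - {x}"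
    using hull_subset[of P convex] by auto
  ultimately show ?thesis
    using hull_minimal[of "P - {x}" "convex hull P - {x}" convex] by auto
qed

text \<open>Dividing the weights by their sum would write \<open>x\<close> as a convex combination
  of \<open>a\<close>, \<open>b\<close>, \<open>c\<close>. These may coincide, so two points are
  handled by repeating one with weight 0. All later geometric contradictions come from this
  lemma.\<close>

lemma convex_position_no_balance:
  fixes x :: "real^2"
  assumes "convex_position P" "x \<in> P" "a \<in> P - {x}" "b \<in> P - {x}" "c \<in> P - {x}"
    and "\<alpha> \<ge> 0" "\<beta> \<ge> 0" "\<gamma> \<ge> 0" "\<alpha> + \<beta> + \<gamma> > 0"
  shows "\<alpha> *\<^sub>R (a - x) + \<beta> *\<^sub>R (b - x) + \<gamma> *\<^sub>R (c - x) \<noteq> 0"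
proof
  let ?s = "\<alpha> + \<beta> + \<gamma>"
  assume "\<alpha> *\<^sub>R (a - x) + \<beta> *\<^sub>R (b - x) + \<gamma> *\<^sub>R (c - x) = 0"
  then have "?s *\<^sub>R x = \<alpha> *\<^sub>R a + \<beta> *\<^sub>R b + \<gamma> *\<^sub>R c"
    by (simp add: algebra_simps)
  then have "x = (1 / ?s) *\<^sub>R (\<alpha> *\<^sub>R a + \<beta> *\<^sub>R b + \<gamma> *\<^sub>R c)"
    using assms by (metis divide_self_if less_irrefl scaleR_one scaleR_scaleR times_divide_eq_left mult_1)
  then have x: "x = (\<alpha>/?s) *\<^sub>R a + (\<beta>/?s) *\<^sub>R b + (\<gamma>/?s) *\<^sub>R c"
    by (simp add: scaleR_add_right)
  have "x \<in> convex hull {a, b, c}"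
    unfolding convex_hull_3 mem_Collect_eq
    by (intro exI[of _ "\<alpha>/?s"] exI[of _ "\<beta>/?s"] exI[of _ "\<gamma>/?s"])
      (use assms x in \<open>simp flip: add_divide_distrib\<close>)
  moreover have "convex hull {a, b, c} \<subseteq> convex hull (P - {x})"
    using assms by (intro hull_mono) auto
  ultimately show False
    using convex_position_hull_diff assms(1,2) by blast
qed

section \<open>Orientation of triples in the plane\<close>

definition cross2 :: "real^2 \<Rightarrow> real^2 \<Rightarrow> real" where
  "cross2 u v = u$1 * v$2 - u$2 * v$1"

text \<open>Twice the signed area of the triangle, positive when \<open>a\<close>, \<open>b\<close>,
  \<open>c\<close> run counterclockwise.\<close>

definition orient :: "real^2 \<Rightarrow> real^2 \<Rightarrow> real^2 \<Rightarrow> real" where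
  "orient a b c = cross2 (b - a) (c - a)"

lemma cross2_commute: "cross2 v u = - cross2 u v"
  by (simp add: cross2_def algebra_simps)

text \<open>Three plane vectors are dependent, and Cramer's rule gives these coefficients. The
  orientations around a point thereby become weights for
  \<open>convex_position_no_balance\<close>.\<close>

lemma cross2_syzygy: "cross2 v w *\<^sub>R u + cross2 w u *\<^sub>R v + cross2 u v *\<^sub>R w = 0"
  by (simp add: cross2_def vec_eq_iff forall_2 algebra_simps)

text \<open>The signed area of a triangle is the sum of the areas that its sides span with an
  arbitrary point \<open>p\<close>.\<close>

lemma orient_eq: "orient a b c = cross2 (a - p) (b - p) + cross2 (b - p) (c - p) - cross2 (a - p) (c - p)"
  by (simp add: orient_def cross2_def algebra_simps)

lemma cross2_eq_0_imp_scaleR: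
  assumes "cross2 u v = 0" "u \<noteq> 0"
  obtains t where "v = t *\<^sub>R u"
proof (cases "u$1 = 0")
  case True
  with assms(2) have "u$2 \<noteq> 0"
    by (simp add: vec_eq_iff forall_2)
  with True show ?thesis
    using assms(1) by (intro that[of "v$2 / u$2"]) (auto simp: vec_eq_iff forall_2 cross2_def)
next
  case False
  then show ?thesis
    using assms(1) by (intro that[of "v$1 / u$1"]) (auto simp: vec_eq_iff forall_2 cross2_def field_simps)
qed

lemma convex_position_orient_nonzero:
  assumes P: "convex_position P" "p \<in> P" "a \<in> P" "b \<in> P" and ne: "a \<noteq> p" "b \<noteq> p" "a \<noteq> b"
  shows "orient p a b \<noteq> 0"
proof
  assume "orient p a b = 0"
  then obtain t where "b - p = t *\<^sub>R (a - p)"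
    using ne cross2_eq_0_imp_scaleR[of "a - p" "b - p"] by (auto simp: orient_def)
  then have b: "b = p + t *\<^sub>R (a - p)"
    by (simp add: algebra_simps)
  have "t \<noteq> 0" "t \<noteq> 1"
    using b ne by auto
  \<comment> \<open>The parameter decides which of the three collinear points is between the other
    two: \<open>p\<close>, \<open>b\<close> or \<open>a\<close> respectively.\<close>
  then consider "t < 0" | "0 < t" "t < 1" | "t > 1"
    by linarith
  then show False
  proof cases
    case 1
    then show False
      using convex_position_no_balance[OF P(1), of p a b b "-t" 1 0] P ne b by auto
  next
    case 2
    then show False
      using convex_position_no_balance[OF P(1), of b p a a "1 - t" t 0] P ne b
      by (auto simp: algebra_simps)
  next
    case 3
    then show False
      using convex_position_no_balance[OF P(1), of a p b b "t - 1" 1 0] P ne b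
      by (auto simp: algebra_simps)
  qed
qed

section \<open>Ranking points by angle\<close>

lemma finite_linear_rank:
  fixes less :: "'a \<Rightarrow> 'a \<Rightarrow> bool"
  assumes fin: "finite P"
    and irrefl: "\<And>a. a \<in> P \<Longrightarrow> \<not> less a a"
    and trans: "\<And>a b c. \<lbrakk>a \<in> P; b \<in> P; c \<in> P; less a b; less b c\<rbrakk> \<Longrightarrow> less a c"
    and total: "\<And>a b. \<lbrakk>a \<in> P; b \<in> P; a \<noteq> b\<rbrakk> \<Longrightarrow> less a b \<or> less b a"
  obtains r :: "'a \<Rightarrow> int" where "\<And>a b. \<lbrakk>a \<in> P; b \<in> P\<rbrakk> \<Longrightarrow> r a < r b \<longleftrightarrow> less a b"
proof
  \<comment> \<open>The rank counts predecessors. It is an integer so that an order can later be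
    reversed by negation.\<close>
  define r where "r a = int (card {u \<in> P. less u a})" for a
  have mono: "r a < r b" if "a \<in> P" "b \<in> P" "less a b" for a b
  proof -
    have "{u \<in> P. less u a} \<subset> {u \<in> P. less u b}"
      using that irrefl trans by blast
    then show ?thesis
      unfolding r_def using fin by (simp add: psubset_card_mono)
  qed
  show "r a < r b \<longleftrightarrow> less a b" if "a \<in> P" "b \<in> P" for a b
    using mono[of a b] mono[of b a] total[of a b] that by fastforce
qed

text \<open>Seen from a chosen \<open>p\<close>, the other points lie within an angle below 180
  degrees, so direction orders them linearly. With \<open>p\<close> put first, this is the
  counterclockwise order along the convex polygon.\<close>

lemma convex_position_rank:
  assumes fin: "finite P" and P: "convex_position P"
  obtains r :: "real^2 \<Rightarrow> int" where "inj_on r P"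
    and "\<And>a b c. \<lbrakk>a \<in> P; b \<in> P; c \<in> P; r a < r b; r b < r c\<rbrakk> \<Longrightarrow> orient a b c > 0"
proof (cases "P = {}")
  case True
  then show ?thesis
    by (auto intro: that)
next
  case False
  then obtain p where p: "p \<in> P"
    by blast
  define less where "less a b \<longleftrightarrow> b \<noteq> p \<and> (a = p \<or> orient p a b > 0)" for a b
  have cyc: "orient p a c > 0"
    if "a \<in> P" "b \<in> P" "c \<in> P" "a \<noteq> p" "b \<noteq> p" "c \<noteq> p" "orient p a b > 0" "orient p b c > 0" for a b c
  proof (rule ccontr)
    assume "\<not> orient p a c > 0"
    then have "orient p c a \<ge> 0"
      using cross2_commute[of "a - p" "c - p"] by (simp add: orient_def)
    \<comment> \<open>All three coefficients of the syzygy are nonnegative, so \<open>p\<close>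
      would lie in the triangle \<open>a\<close>, \<open>b\<close>, \<open>c\<close>.\<close>
    then show False
      using convex_position_no_balance[OF P p, of a b c "orient p b c" "orient p c a" "orient p a b"]
        cross2_syzygy[of "b - p" "c - p" "a - p"] that by (simp add: orient_def)
  qed
  have self: "orient p a a = 0" for a
    by (simp add: orient_def cross2_def)
  obtain r :: "real^2 \<Rightarrow> int" where r: "\<And>a b. \<lbrakk>a \<in> P; b \<in> P\<rbrakk> \<Longrightarrow> r a < r b \<longleftrightarrow> less a b"
  proof (rule finite_linear_rank[OF fin, of less])
    show "\<not> less a a" if "a \<in> P" for a
      using self by (auto simp: less_def)
    show "less a c" if "a \<in> P" "b \<in> P" "c \<in> P" "less a b" "less b c" for a b c
      using that cyc[of a b c] by (auto simp: less_def)
    show "less a b \<or> less b a" if "a \<in> P" "b \<in> P" "a \<noteq> b" for a b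
      using that convex_position_orient_nonzero[OF P p, of a b] cross2_commute[of "a - p" "b - p"]
      by (cases "a = p"; cases "b = p") (auto simp: less_def orient_def)
  qed (rule that)
  show ?thesis
  proof
    show "inj_on r P"
    proof (rule inj_onI, rule ccontr)
      fix a b assume ab: "a \<in> P" "b \<in> P" "r a = r b" "a \<noteq> b"
      then have "\<not> less a b" "\<not> less b a"
        using r by (metis less_irrefl)+
      then show False
        using ab convex_position_orient_nonzero[OF P p, of a b] cross2_commute[of "a - p" "b - p"]
        by (auto simp: less_def orient_def)
    qed
    show "orient a b c > 0" if abc: "a \<in> P" "b \<in> P" "c \<in> P" "r a < r b" "r b < r c" for a b c
    proof (cases "a = p")
      case True
      then show ?thesis
        using abc r[of b c] r[of a b] by (auto simp: less_def)
    next
      case False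
      have "r a < r c"
        using abc by simp
      then have pos: "orient p a b > 0" "orient p b c > 0" "orient p a c > 0"
        and ne: "b \<noteq> p" "c \<noteq> p" "a \<noteq> b" "b \<noteq> c"
        using abc r[of a b] r[of b c] r[of a c] False by (auto simp: less_def)
      show ?thesis
      proof (rule ccontr)
        assume "\<not> orient a b c > 0"
        then have le: "orient p a b + orient p b c \<le> orient p a c"
          unfolding orient_eq[of a b c p] by (simp add: orient_def)
        have "orient p b c *\<^sub>R (a - p) + orient p a b *\<^sub>R (c - p) = orient p a c *\<^sub>R (b - p)"
          using cross2_syzygy[of "b - p" "c - p" "a - p"] cross2_commute[of "c - p" "a - p"]
          by (simp add: orient_def algebra_simps)
        \<comment> \<open>The relation is regrouped around \<open>b\<close>. By \<open>le\<close>
          the first coefficient is nonnegative, so \<open>b\<close> would lie in the triangle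
          \<open>p\<close>, \<open>a\<close>, \<open>c\<close>.\<close>
        then have "(orient p a c - orient p a b - orient p b c) *\<^sub>R (p - b)
            + orient p b c *\<^sub>R (a - b) + orient p a b *\<^sub>R (c - b) = 0"
          by (simp add: algebra_simps)
        then show False
          using convex_position_no_balance[OF P, of b p a c
              "orient p a c - orient p a b - orient p b c" "orient p b c" "orient p a b"]
            abc p ne False le pos by auto
      qed
    qed
  qed
qed

text \<open>The diagonals of a convex quadrilateral meet; the syzygy at \<open>a\<close> gives the
  meeting point explicitly.\<close>

lemma orient_segments_meet:
  assumes "orient a b c > 0" "orient a c d > 0" "orient a b d > 0" "orient b c d > 0"
  shows "closed_segment a c \<inter> closed_segment b d \<noteq> {}"
proof -
  let ?x = "orient a c d" and ?y = "orient a b c" and ?z = "orient a b d"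
  \<comment> \<open>This is twice the area of the quadrilateral. It exceeds \<open>?z\<close> by
    \<open>orient b c d\<close>, which keeps the meeting point on the segment from \<open>a\<close>
    to \<open>c\<close>.\<close>
  define s where "s = ?x + ?y"
  have "?z < s"
    using assms(4) unfolding s_def orient_eq[of b c d a] by (simp add: orient_def)
  then have s: "s > 0" "0 \<le> ?z / s" "?z / s \<le> 1" "0 \<le> ?y / s" "?y / s \<le> 1" and x: "?x / s = 1 - ?y / s"
    using assms by (auto simp: s_def field_simps)
  have "?x *\<^sub>R (b - a) + ?y *\<^sub>R (d - a) = ?z *\<^sub>R (c - a)"
    using cross2_syzygy[of "c - a" "d - a" "b - a"] cross2_commute[of "d - a" "b - a"]
    by (simp add: orient_def algebra_simps)
  then have "(1 / s) *\<^sub>R (?z *\<^sub>R (c - a)) = (1 / s) *\<^sub>R (?x *\<^sub>R (b - a) + ?y *\<^sub>R (d - a))"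
    by simp
  then have "(?z / s) *\<^sub>R (c - a) = (1 - ?y / s) *\<^sub>R (b - a) + (?y / s) *\<^sub>R (d - a)"
    by (simp add: scaleR_add_right flip: x)
  then have "(1 - ?z / s) *\<^sub>R a + (?z / s) *\<^sub>R c = (1 - ?y / s) *\<^sub>R b + (?y / s) *\<^sub>R d"
    by (simp add: algebra_simps)
  moreover have "(1 - ?z / s) *\<^sub>R a + (?z / s) *\<^sub>R c \<in> closed_segment a c"
    using s by (auto simp: closed_segment_def)
  moreover have "(1 - ?y / s) *\<^sub>R b + (?y / s) *\<^sub>R d \<in> closed_segment b d"
    using s by (auto simp: closed_segment_def)
  ultimately show ?thesis
    by auto
qed

section \<open>Ramsey's theorem for increasing triples\<close>

text \<open>Ramsey's theorem for 3-element sets, with colours coded by numbers and the homogeneous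
  set listed increasingly by \<open>h\<close>. The bound \<open>N\<close> precedes the colouring, so
  it serves all drawings at once.\<close>

lemma ramsey_ordered_triples:
  fixes C :: "'c set" and m :: nat
  assumes "finite C"
  shows "\<exists>N::nat. \<forall>col. (\<forall>a b c. a < b \<longrightarrow> b < c \<longrightarrow> c < N \<longrightarrow> col a b c \<in> C) \<longrightarrow>
    (\<exists>(h :: nat \<Rightarrow> nat) \<kappa>. (\<forall>i<m. h i < N) \<and> (\<forall>i j. i < j \<longrightarrow> j < m \<longrightarrow> h i < h j) \<and>
      (\<forall>i j l. i < j \<longrightarrow> j < l \<longrightarrow> l < m \<longrightarrow> col (h i) (h j) (h l) = \<kappa>))"
proof -
  obtain n and enc :: "'c \<Rightarrow> nat" where enc: "enc ` C = {i. i < n}" "inj_on enc C"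
    using finite_imp_inj_to_nat_seg[OF assms] by metis
  obtain N :: nat where N: "partn_lst {..<N} (replicate n m) 3"
    using ramsey_full by blast
  show ?thesis
  proof (intro exI[of _ N] allI impI)
    fix col :: "nat \<Rightarrow> nat \<Rightarrow> nat \<Rightarrow> 'c"
    assume "\<forall>a b c. a < b \<longrightarrow> b < c \<longrightarrow> c < N \<longrightarrow> col a b c \<in> C"
    then have col: "\<And>a b c. \<lbrakk>a < b; b < c; c < N\<rbrakk> \<Longrightarrow> col a b c \<in> C"
      by blast
    \<comment> \<open>Sorting a 3-element set turns the colouring of increasing triples into one of
      sets.\<close>
    define f where "f X = (let xs = sorted_list_of_set X in enc (col (xs!0) (xs!1) (xs!2)))" for X
    have f: "f {a, b, c} = enc (col a b c)" if "a < b" "b < c" for a b c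
    proof -
      have "sorted_list_of_set {a, b, c} = [a, b, c]"
        using that by (intro sorted_list_of_set_unique[THEN iffD1]) auto
      then show ?thesis
        by (simp add: f_def Let_def)
    qed
    have "f \<in> [{..<N}]\<^bsup>3\<^esup> \<rightarrow> {..<n}"
    proof
      fix X assume "X \<in> [{..<N}]\<^bsup>3\<^esup>"
      then obtain a b c where "X = {a, b, c}" "a < b" "b < c" "c < N"
        by (auto simp: ordered_nsets_3_eq)
      then have "f X = enc (col a b c)" "enc (col a b c) \<in> enc ` C"
        using f col by blast+
      then show "f X \<in> {..<n}"
        using enc(1) by auto
    qed
    then obtain i H where "i < length (replicate n m)" "H \<in> [{..<N}]\<^bsup>(replicate n m ! i)\<^esup>"
        and fH: "f ` ([H]\<^bsup>3\<^esup>) \<subseteq> {i}"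
      by (rule partn_lstE[OF N]) (rule length_replicate)
    then have H: "H \<in> [{..<N}]\<^bsup>m\<^esup>"
      by simp
    define h where "h j = sorted_list_of_set H ! j" for j
    have fin: "finite H" and card: "card H = m" and "H \<subseteq> {..<N}"
      using H by (auto simp: nsets_def)
    have hH: "h j \<in> H" if "j < m" for j
      using that fin card nth_mem[of j "sorted_list_of_set H"] by (simp add: h_def)
    have hmono: "h j < h l" if "j < l" "l < m" for j l
      using that card by (simp add: h_def sorted_wrt_nth_less[OF strict_sorted_list_of_set])
    have "col (h j) (h k) (h l) = inv_into C enc i" if "j < k" "k < l" "l < m" for j k l
    proof -
      have lt: "h j < h k" "h k < h l" "h l < N"
        using that hmono hH[of l] \<open>H \<subseteq> {..<N}\<close> by auto
      have "{h j, h k, h l} \<in> [H]\<^bsup>3\<^esup>"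
        using that lt hH by (auto simp: nsets_def)
      then have "enc (col (h j) (h k) (h l)) = i"
        using fH f[OF lt(1,2)] by auto
      then show ?thesis
        using inv_into_f_f[OF enc(2) col[OF lt]] by simp
    qed
    then show "\<exists>h \<kappa>. (\<forall>i<m. h i < N) \<and> (\<forall>i j. i < j \<longrightarrow> j < m \<longrightarrow> h i < h j) \<and>
        (\<forall>i j l. i < j \<longrightarrow> j < l \<longrightarrow> l < m \<longrightarrow> col (h i) (h j) (h l) = \<kappa>)"
      using hmono hH \<open>H \<subseteq> {..<N}\<close> by (intro exI[of _ h] exI[of _ "inv_into C enc i"]) blast
  qed
qed

section \<open>Crossings among homogeneous patterns of places\<close>

text \<open>Only the alternation in which the first pair starts earlier is meant; exchanging the
  pairs gives the other one.\<close>

definition interleaved :: "int \<Rightarrow> int \<Rightarrow> int \<Rightarrow> int \<Rightarrow> bool" where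
  "interleaved a b c d \<longleftrightarrow> min a b < min c d \<and> min c d < max a b \<and> max a b < max c d"

lemma interleaved_uminus: "interleaved (- a) (- b) (- c) (- d) \<longleftrightarrow> interleaved c d a b"
  by (auto simp: interleaved_def min_def max_def)

text \<open>Here \<open>x i\<close> is the place of the \<open>i\<close>-th chosen original vertex and \<open>y i j\<close> that of the
  subdivision vertex of \<open>{i, j}\<close>. Crossings are only excluded between two lower halves
  \<open>(x i, y i j)\<close> and between two upper halves \<open>(x j, y i j)\<close>.\<close>

lemma no_homogeneous_increasing:
  fixes x :: "nat \<Rightarrow> int" and y :: "nat \<Rightarrow> nat \<Rightarrow> int"
  assumes xmono: "\<And>i j. \<lbrakk>i < j; j < 5\<rbrakk> \<Longrightarrow> x i < x j"
    and yx: "\<And>i j l. \<lbrakk>i < j; j < 5; l < 5\<rbrakk> \<Longrightarrow> y i j \<noteq> x l"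
    and yy: "\<And>i j k l. \<lbrakk>i < j; j < 5; k < l; l < 5; (i, j) \<noteq> (k, l)\<rbrakk> \<Longrightarrow> y i j \<noteq> y k l"
    and below: "\<And>i j. \<lbrakk>i < j; j < 5\<rbrakk> \<Longrightarrow> y i j < x i \<longleftrightarrow> B1"
    and above: "\<And>i j. \<lbrakk>i < j; j < 5\<rbrakk> \<Longrightarrow> y i j < x j \<longleftrightarrow> B2"
    and left: "\<And>l i j. \<lbrakk>l < i; i < j; j < 5\<rbrakk> \<Longrightarrow> y i j < x l \<longleftrightarrow> C1"
    and mid: "\<And>l i j. \<lbrakk>i < l; l < j; j < 5\<rbrakk> \<Longrightarrow> y i j < x l \<longleftrightarrow> C2"
    and right: "\<And>l i j. \<lbrakk>i < j; j < l; l < 5\<rbrakk> \<Longrightarrow> y i j < x l \<longleftrightarrow> C3"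
    and lower: "\<And>i j k l. \<lbrakk>i < j; j < 5; k < l; l < 5; i \<noteq> k\<rbrakk> \<Longrightarrow>
      \<not> interleaved (x i) (y i j) (x k) (y k l)"
    and upper: "\<And>i j k l. \<lbrakk>i < j; j < 5; k < l; l < 5; j \<noteq> l\<rbrakk> \<Longrightarrow>
      \<not> interleaved (x j) (y i j) (x l) (y k l)"
  shows False
proof -
  have x: "x 0 < x 1" "x 1 < x 2" "x 2 < x 3" "x 3 < x 4"
    using xmono by simp_all
  consider "\<not> B1" "B2" "C2" | "\<not> B1" "B2" "\<not> C2" | "B1" "\<not> C1" | "B1" "C1"
    | "\<not> B1" "\<not> B2" "C3" | "\<not> B1" "\<not> B2" "\<not> C3"
    by blast
  then show False
  proof cases
    case 1
    \<comment> \<open>Each \<open>y i j\<close> lies after \<open>x i\<close> but before the next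
      chosen vertex, so two upper halves shift past each other.\<close>
    then have "y 0 3 < x 1" "x 1 < y 1 4" "y 1 4 < x 2"
      using mid[of 0 1 3] mid[of 1 2 4] below[of 1 4] yx[of 1 4 1] by auto
    then show False
      using upper[of 0 3 1 4] x by (simp add: interleaved_def)
  next
    case 2
    \<comment> \<open>Mirror situation: \<open>y i j\<close> lies just before \<open>x j\<close>,
      and two lower halves cross.\<close>
    then have "x 2 < y 0 3" "y 0 3 < x 3" "x 3 < y 1 4"
      using mid[of 0 2 3] mid[of 1 3 4] above[of 0 3] yx[of 0 3 2] yx[of 1 4 3] by auto
    then show False
      using lower[of 0 3 1 4] x by (simp add: interleaved_def)
  next
    case 3
    then have "y 1 3 < x 1" "x 1 < y 2 4" "y 2 4 < x 2"
      using left[of 1 2 4] below[of 1 3] below[of 2 4] yx[of 2 4 1] by auto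
    then show False
      using upper[of 1 3 2 4] x by (simp add: interleaved_def)
  next
    case 4
    \<comment> \<open>Both places precede all \<open>x\<close>, in unknown order. The index pairs
      are nested, so their lower and upper ends are oppositely ordered: the lower halves cross if
      \<open>y 1 4\<close> comes first, the upper halves otherwise.\<close>
    then have "y 1 4 < x 0" "y 2 3 < x 0"
      using left[of 0 1 4] left[of 0 2 3] by auto
    then show False
      using lower[of 1 4 2 3] upper[of 2 3 1 4] yy[of 1 4 2 3] x by (simp add: interleaved_def)
  next
    case 5
    then have "x 2 < y 0 2" "y 0 2 < x 3" "x 3 < y 1 3"
      using right[of 0 2 3] above[of 0 2] above[of 1 3] yx[of 0 2 2] yx[of 1 3 3] by auto
    then show False
      using lower[of 0 2 1 3] x by (simp add: interleaved_def)
  next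
    case 6
    \<comment> \<open>Nested pairs again, now with both places after all \<open>x\<close>: the lower
      halves cross if \<open>y 0 3\<close> comes first, the upper halves otherwise.\<close>
    then have "x 4 < y 0 3" "x 4 < y 1 2"
      using right[of 0 3 4] right[of 1 2 4] yx[of 0 3 4] yx[of 1 2 4] by auto
    then show False
      using lower[of 0 3 1 2] upper[of 1 2 0 3] yy[of 0 3 1 2] x by (simp add: interleaved_def)
  qed
qed

text \<open>If the \<open>x i\<close> decrease, negating all places makes them increase and
  complements every comparison between a \<open>y\<close> and an \<open>x\<close>, since ties are
  excluded.\<close>

lemma no_homogeneous:
  fixes x :: "nat \<Rightarrow> int" and y :: "nat \<Rightarrow> nat \<Rightarrow> int"
  assumes xord: "\<And>i j. \<lbrakk>i < j; j < 5\<rbrakk> \<Longrightarrow> x i < x j \<longleftrightarrow> A"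
    and xne: "\<And>i j. \<lbrakk>i < j; j < 5\<rbrakk> \<Longrightarrow> x i \<noteq> x j"
    and yx: "\<And>i j l. \<lbrakk>i < j; j < 5; l < 5\<rbrakk> \<Longrightarrow> y i j \<noteq> x l"
    and yy: "\<And>i j k l. \<lbrakk>i < j; j < 5; k < l; l < 5; (i, j) \<noteq> (k, l)\<rbrakk> \<Longrightarrow> y i j \<noteq> y k l"
    and below: "\<And>i j. \<lbrakk>i < j; j < 5\<rbrakk> \<Longrightarrow> y i j < x i \<longleftrightarrow> B1"
    and above: "\<And>i j. \<lbrakk>i < j; j < 5\<rbrakk> \<Longrightarrow> y i j < x j \<longleftrightarrow> B2"
    and left: "\<And>l i j. \<lbrakk>l < i; i < j; j < 5\<rbrakk> \<Longrightarrow> y i j < x l \<longleftrightarrow> C1"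
    and mid: "\<And>l i j. \<lbrakk>i < l; l < j; j < 5\<rbrakk> \<Longrightarrow> y i j < x l \<longleftrightarrow> C2"
    and right: "\<And>l i j. \<lbrakk>i < j; j < l; l < 5\<rbrakk> \<Longrightarrow> y i j < x l \<longleftrightarrow> C3"
    and lower: "\<And>i j k l. \<lbrakk>i < j; j < 5; k < l; l < 5; i \<noteq> k\<rbrakk> \<Longrightarrow>
      \<not> interleaved (x i) (y i j) (x k) (y k l)"
    and upper: "\<And>i j k l. \<lbrakk>i < j; j < 5; k < l; l < 5; j \<noteq> l\<rbrakk> \<Longrightarrow>
      \<not> interleaved (x j) (y i j) (x l) (y k l)"
  shows False
proof (cases A)
  case True
  show False
  proof (rule no_homogeneous_increasing[of x y B1 B2 C1 C2 C3])
    show "x i < x j" if "i < j" "j < 5" for i j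
      using xord[OF that] True by simp
  qed (fact yx yy below above left mid right lower upper)+
next
  case False
  have flip: "- y i j < - x l \<longleftrightarrow> \<not> y i j < x l" if "i < j" "j < 5" "l < 5" for i j l
    using yx[OF that] by auto
  show False
  proof (rule no_homogeneous_increasing[of "\<lambda>i. - x i" "\<lambda>i j. - y i j" "\<not> B1" "\<not> B2" "\<not> C1" "\<not> C2" "\<not> C3"])
    show "- x i < - x j" if "i < j" "j < 5" for i j
      using xord[OF that] xne[of i j] that False by auto
    show "\<not> interleaved (- x i) (- y i j) (- x k) (- y k l)"
      if "i < j" "j < 5" "k < l" "l < 5" "i \<noteq> k" for i j k l
      using that lower[of k l i j] by (auto simp: interleaved_uminus)
    show "\<not> interleaved (- x j) (- y i j) (- x l) (- y k l)"
      if "i < j" "j < 5" "k < l" "l < 5" "j \<noteq> l" for i j k l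
      using that upper[of k l i j] by (auto simp: interleaved_uminus)
    show "- y i j < - x i \<longleftrightarrow> \<not> B1" if "i < j" "j < 5" for i j
      using flip[of i j i] below[OF that] that by simp
    show "- y i j < - x j \<longleftrightarrow> \<not> B2" if "i < j" "j < 5" for i j
      using flip[of i j j] above[OF that] that by simp
    show "- y i j < - x l \<longleftrightarrow> \<not> C1" if "l < i" "i < j" "j < 5" for l i j
      using flip[of i j l] left[OF that] that by simp
    show "- y i j < - x l \<longleftrightarrow> \<not> C2" if "i < l" "l < j" "j < 5" for l i j
      using flip[of i j l] mid[OF that] that by simp
    show "- y i j < - x l \<longleftrightarrow> \<not> C3" if "i < j" "j < l" "l < 5" for l i j
      using flip[of i j l] right[OF that] that by simp
  qed (use yx yy in simp_all)
qed

section \<open>From book drawings to homogeneous patterns\<close>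

text \<open>Ranking the vertices along the polygon reduces the geometry to order: edges with
  alternating endpoints have meeting segments and no common endpoint, so they cross.\<close>

lemma book_drawing_rank:
  assumes fin: "finite V" and draw: "book_drawing V E n pos layer"
  obtains \<rho> :: "'a \<Rightarrow> int" where "inj_on \<rho> V"
    and "\<And>u v w z. \<lbrakk>{u, v} \<subseteq> V; {w, z} \<subseteq> V; {u, v} \<in> E; {w, z} \<in> E; layer {u, v} = layer {w, z}\<rbrakk> \<Longrightarrow>
      \<not> interleaved (\<rho> u) (\<rho> v) (\<rho> w) (\<rho> z)"
proof -
  have inj: "inj_on pos V" and conv: "convex_position (pos ` V)"
    using draw by (auto simp: book_drawing_def)
  obtain r :: "real^2 \<Rightarrow> int" where r: "inj_on r (pos ` V)"
    and orient: "\<And>a b c. \<lbrakk>a \<in> pos ` V; b \<in> pos ` V; c \<in> pos ` V; r a < r b; r b < r c\<rbrakk> \<Longrightarrow> orient a b c > 0"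
    using convex_position_rank[OF finite_imageI[OF fin] conv] by metis
  define \<rho> where "\<rho> v = r (pos v)" for v
  have sorted: False
    if V: "u \<in> V" "v \<in> V" "w \<in> V" "z \<in> V"
      and E: "{u, v} \<in> E" "{w, z} \<in> E" "layer {u, v} = layer {w, z}"
      and lt: "\<rho> u < \<rho> w" "\<rho> w < \<rho> v" "\<rho> v < \<rho> z" for u v w z
  proof -
    have "closed_segment (pos u) (pos v) \<inter> closed_segment (pos w) (pos z) \<noteq> {}"
      using V lt by (intro orient_segments_meet orient) (auto simp: \<rho>_def)
    moreover have disj: "{u, v} \<inter> {w, z} = {}"
      using lt by auto
    ultimately have "edges_cross pos {u, v} {w, z}"
      by (auto simp: edges_cross_def edge_segment_doubleton)
    moreover have "{u, v} \<noteq> {w, z}"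
      using disj by auto
    ultimately show False
      using draw E by (auto simp: book_drawing_def)
  qed
  show ?thesis
  proof
    show "inj_on \<rho> V"
      using inj r by (auto simp: \<rho>_def inj_on_def)
    show "\<not> interleaved (\<rho> u) (\<rho> v) (\<rho> w) (\<rho> z)"
      if "{u, v} \<subseteq> V" "{w, z} \<subseteq> V" "{u, v} \<in> E" "{w, z} \<in> E" "layer {u, v} = layer {w, z}" for u v w z
      \<comment> \<open>The four instances cover both orders of the endpoints of each edge.\<close>
      using that sorted[of u v w z] sorted[of v u w z] sorted[of u v z w] sorted[of v u z w]
      by (auto simp: interleaved_def min_def max_def insert_commute split: if_splits)
  qed
qed

lemma subdivided_complete_not_book_drawing:
  obtains k where "k > 0"
    "\<And>pos layer. \<not> book_drawing (subdivided_complete_verts k) (subdivided_complete_edges k) n pos layer"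
proof -
  let ?C = "{..<n} \<times> {..<n} \<times> (UNIV :: (bool \<times> bool \<times> bool \<times> bool \<times> bool \<times> bool) set)"
  have "finite ?C"
    by simp
  from ramsey_ordered_triples[OF this, of 6] obtain N :: nat where N:
    "\<forall>col. (\<forall>a b c. a < b \<longrightarrow> b < c \<longrightarrow> c < N \<longrightarrow> col a b c \<in> ?C) \<longrightarrow>
      (\<exists>(h :: nat \<Rightarrow> nat) \<kappa>. (\<forall>i<6. h i < N) \<and> (\<forall>i j. i < j \<longrightarrow> j < 6 \<longrightarrow> h i < h j) \<and>
        (\<forall>i j l. i < j \<longrightarrow> j < l \<longrightarrow> l < 6 \<longrightarrow> col (h i) (h j) (h l) = \<kappa>))"
    by (rule exE)
  \<comment> \<open>The successor ensures \<open>k > 0\<close> even when \<open>N\<close> is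
    0.\<close>
  define k where "k = Suc N"
  let ?V = "subdivided_complete_verts k" and ?E = "subdivided_complete_edges k"
  have "\<not> book_drawing ?V ?E n pos layer" for pos layer
  proof
    assume draw: "book_drawing ?V ?E n pos layer"
    have "finite ?V"
      using finite_simple_graph_subdivided_complete by (auto simp: finite_simple_graph_def)
    then obtain \<rho> :: "nat set \<Rightarrow> int" where inj: "inj_on \<rho> ?V"
      and nocross: "\<And>u v w z. \<lbrakk>{u, v} \<subseteq> ?V; {w, z} \<subseteq> ?V; {u, v} \<in> ?E; {w, z} \<in> ?E; layer {u, v} = layer {w, z}\<rbrakk> \<Longrightarrow>
        \<not> interleaved (\<rho> u) (\<rho> v) (\<rho> w) (\<rho> z)"
      using book_drawing_rank[OF _ draw] by metis
    have V1: "{a} \<in> ?V" if "a < N" for a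
      using that by (auto simp: subdivided_complete_verts_def k_def)
    have V2: "{a, b} \<in> ?V" if "a < b" "b < N" for a b
      using that by (auto simp: subdivided_complete_verts_def k_def)
    have E: "{{a}, {a, b}} \<in> ?E" "{{b}, {a, b}} \<in> ?E" if "a < b" "b < N" for a b
    proof -
      have edge: "{s, s'} \<in> ?E" if "s \<in> ?V" "s' \<in> ?V" "s \<subset> s'" for s s'
        using that unfolding subdivided_complete_edges_def by blast
      have "{a} \<subset> {a, b}" "{b} \<subset> {a, b}"
        using that by auto
      then show "{{a}, {a, b}} \<in> ?E" "{{b}, {a, b}} \<in> ?E"
        using that V1[of a] V1[of b] V2[of a b] by (simp_all add: edge)
    qed
    define X where "X a = \<rho> {a}" for a
    define Y where "Y a b = \<rho> {a, b}" for a b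
    define L where "L a b = layer {{a}, {a, b}}" for a b
    define U where "U a b = layer {{b}, {a, b}}" for a b
    \<comment> \<open>The colour of a triple holds both layers of its first pair and all comparisons
      that \<open>no_homogeneous\<close> requires to be uniform.\<close>
    define col where "col a b c = (L a b, U a b,
      X a < X b, Y a b < X a, Y a b < X b, Y b c < X a, Y a c < X b, Y a b < X c)" for a b c
    have "layer e < n" if "e \<in> ?E" for e
      using draw that by (simp add: book_drawing_def)
    then have col: "\<forall>a b c. a < b \<longrightarrow> b < c \<longrightarrow> c < N \<longrightarrow> col a b c \<in> ?C"
      using E by (simp add: col_def L_def U_def)
    obtain h :: "nat \<Rightarrow> nat" and \<kappa> where homog: "(\<forall>i<6. h i < N) \<and> (\<forall>i j. i < j \<longrightarrow> j < 6 \<longrightarrow> h i < h j) \<and>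
        (\<forall>i j l. i < j \<longrightarrow> j < l \<longrightarrow> l < 6 \<longrightarrow> col (h i) (h j) (h l) = \<kappa>)"
      using mp[OF spec[OF N, of col] col] by (elim exE)
    have hN: "h i < N" if "i < 6" for i
      using homog that by simp
    have h: "h i < h j" if "i < j" "j < 6" for i j
      using homog that by simp
    have hcol: "col (h i) (h j) (h l) = \<kappa>" if "i < j" "j < l" "l < 6" for i j l
      using homog that by simp
    obtain cL cU A B1 B2 C1 C2 C3 where \<kappa>: "\<kappa> = (cL, cU, A, B1, B2, C1, C2, C3)"
      by (metis prod.exhaust)
    \<comment> \<open>The sixth chosen vertex, index 5, only completes a pair to a triple; this is
      why six vertices are requested and five are used afterwards.\<close>
    have pair: "L (h i) (h j) = cL" "U (h i) (h j) = cU" "X (h i) < X (h j) \<longleftrightarrow> A"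
        "Y (h i) (h j) < X (h i) \<longleftrightarrow> B1" "Y (h i) (h j) < X (h j) \<longleftrightarrow> B2" if "i < j" "j < 5" for i j
      using hcol[of i j 5] that by (auto simp: col_def \<kappa>)
    have triple: "Y (h j) (h l) < X (h i) \<longleftrightarrow> C1" "Y (h i) (h l) < X (h j) \<longleftrightarrow> C2"
        "Y (h i) (h j) < X (h l) \<longleftrightarrow> C3" if "i < j" "j < l" "l < 5" for i j l
      using hcol[of i j l] that by (auto simp: col_def \<kappa>)
    have hne: "h i \<noteq> h j" if "i \<noteq> j" "i < 5" "j < 5" for i j
      using h[of i j] h[of j i] that by (cases "i < j") auto
    show False
    proof (rule no_homogeneous[of "\<lambda>i. X (h i)" A "\<lambda>i j. Y (h i) (h j)" B1 B2 C1 C2 C3])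
      show "X (h i) \<noteq> X (h j)" if "i < j" "j < 5" for i j
        using inj_onD[OF inj, of "{h i}" "{h j}"] V1 hN h[of i j] that by (auto simp: X_def)
      show "Y (h i) (h j) \<noteq> X (h l)" if "i < j" "j < 5" "l < 5" for i j l
      proof -
        have "{h i, h j} \<noteq> {h l}"
          using h[of i j] that by auto
        then show ?thesis
          using inj_onD[OF inj, of "{h i, h j}" "{h l}"] V1[of "h l"] V2[of "h i" "h j"]
            hN[of l] hN[of j] h[of i j] that by (auto simp: X_def Y_def)
      qed
      show "Y (h i) (h j) \<noteq> Y (h k) (h l)"
        if "i < j" "j < 5" "k < l" "l < 5" "(i, j) \<noteq> (k, l)" for i j k l
      proof -
        have "{h i, h j} \<noteq> {h k, h l}"
          using that hne[of i k] hne[of j l] h[of i j] h[of k l] by (auto simp: doubleton_eq_iff)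
        then show ?thesis
          using inj_onD[OF inj, of "{h i, h j}" "{h k, h l}"] V2[of "h i" "h j"] V2[of "h k" "h l"]
            hN[of j] hN[of l] h[of i j] h[of k l] that by (auto simp: Y_def)
      qed
      have vert: "{h i} \<in> ?V" "{h j} \<in> ?V" "{h i, h j} \<in> ?V"
          "{{h i}, {h i, h j}} \<in> ?E" "{{h j}, {h i, h j}} \<in> ?E"
        if "i < j" "j < 5" for i j
        using that V1 V2 E h[of i j] hN[of i] hN[of j] by simp_all
      show "\<not> interleaved (X (h i)) (Y (h i) (h j)) (X (h k)) (Y (h k) (h l))"
        if "i < j" "j < 5" "k < l" "l < 5" "i \<noteq> k" for i j k l
        unfolding X_def Y_def using that vert[of i j] vert[of k l] pair(1)[of i j] pair(1)[of k l]
        by (intro nocross) (simp_all add: L_def)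
      show "\<not> interleaved (X (h j)) (Y (h i) (h j)) (X (h l)) (Y (h k) (h l))"
        if "i < j" "j < 5" "k < l" "l < 5" "j \<noteq> l" for i j k l
        unfolding X_def Y_def using that vert[of i j] vert[of k l] pair(2)[of i j] pair(2)[of k l]
        by (intro nocross) (simp_all add: U_def)
    qed (fact pair(3-5) triple)+
  qed
  then show ?thesis
    by (intro that[of k]) (auto simp: k_def)
qed

theorem theorem2:
  fixes t :: nat
  assumes "t > 0"
  shows "\<exists>k::nat. k > 0 \<and>
    book_thickness (subdivided_complete_verts k) (subdivided_complete_edges k) \<ge> t"
proof -
  obtain k where k: "k > 0"
    "\<And>pos layer. \<not> book_drawing (subdivided_complete_verts k) (subdivided_complete_edges k) t pos layer"
    using subdivided_complete_not_book_drawing by metis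
  let ?V = "subdivided_complete_verts k" and ?E = "subdivided_complete_edges k"
  \<comment> \<open>Existence of some drawing makes the least number of layers an attained
    one.\<close>
  obtain pos layer where draw: "book_drawing ?V ?E (book_thickness ?V ?E) pos layer"
    unfolding book_thickness_def
    using LeastI_ex[OF book_drawing_exists[OF finite_simple_graph_subdivided_complete[of k]]] by blast
  have "t \<le> book_thickness ?V ?E"
  proof (rule ccontr)
    assume "\<not> t \<le> book_thickness ?V ?E"
    \<comment> \<open>A drawing with fewer layers is also one with \<open>t\<close> layers, as
      layers may stay empty.\<close>
    then have "book_drawing ?V ?E t pos layer"
      using draw by (fastforce simp: book_drawing_def)
    with k(2) show False
      by blast
  qed
  with k(1) show ?thesis
    by blast
qed

end
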